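(* Let $B:\ell^1\to\ell^2$ be any surjective bounded linear operator. Then: (1) $B$ is of hybrid-type, and the operator equation $Bx=y$ ($x\in\ell^1$, $y\in\ell^2$) is ill-posed of type I. (2) The null-space $\mathcal{N}(B)$ is uncomplemented in $\ell^1$. Both the dimension and the codimension of $\mathcal{N}(B)$ in $\ell^1$ are not finite. Consequently, $B$ is non-injective. (3) The adjoint operator $B^*:\ell^2\to\ell^\infty$ is injective and hence not strictly singular, and its range is closed and infinite-dimensional with $\mathcal{R}(B^* )=\mathcal{N}(B)^\perp$. Therefore, the adjoint operator equation $B^*\eta=z$ ($\eta\in\ell^2$, $z\in\ell^\infty$) is well-posed. (4) If moreover $B$ is of Mazur-type, i.e. $Bx=\sum_{k=1}^\infty x_k\,\zeta^{(k)}\in\ell^2$ for all $x=(x_1,x_2,\ldots)\in\ell^1$, where $(\zeta^{(k)})_{k\in\mathbb{N}}$ is a sequence of pairwise distinct elements of the unit sphere of $\ell^2$ that is dense in this unit sphere, then $$B^*\eta=\bigl(\langle\eta,\zeta^{(1)}\rangle_{\ell^2},\langle\eta,\zeta^{(2)}\rangle_{\ell^2},\ldots\bigr)\in\ell^\infty\qquad\text{for all }\eta\in\ell^2 .$$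
   Context: The sequence spaces $\ell^1,\ell^2,\ell^\infty$ (indexed by $\mathbb{N}=\{1,2,\ldots\}$) are real. The dual of $\ell^2$ is identified with $\ell^2$ via the inner product and the dual of $\ell^1$ with $\ell^\infty$, so that the adjoint $B^*:\ell^2\to\ell^\infty$ is determined by $\langle\eta,Bx\rangle_{\ell^2}=\sum_k [B^*\eta]_k x_k$ for all $\eta\in\ell^2$, $x\in\ell^1$. $\mathcal{R}(\cdot)$ denotes the range and $\mathcal{N}(\cdot)$ the null-space. $\mathcal{N}(B)^\perp=\{\xi\in\ell^\infty:\sum_k\xi_kx_k=0\ \text{for all }x\in\mathcal{N}(B)\}$ is the annihilator of $\mathcal{N}(B)$. The codimension of $\mathcal{N}(B)$ is the dimension of $\ell^1/\mathcal{N}(B)$. Let $A:X\to Y$ be a bounded linear operator between infinite-dimensional Banach spaces. Complemented: a closed subspace $N$ of $X$ is complemented in $X$ if there is a closed subspace $U$ of $X$ with $X=N\oplus U$ (direct sum); otherwise it is uncomplemented. Well-posedness and ill-posedness: the equation $Ax=y$ is well-posed if $\mathcal{R}(A)$ is a closed subset of $Y$ and, moreover, $\mathcal{N}(A)$ is complemented in $X$; otherwise it is ill-posed. In the ill-posed case, it is ill-posed of type I if $\mathcal{R}(A)$ contains an infinite-dimensional closed subspace of $Y$, and ill-posed of type II otherwise. Strictly singular: $A$ is strictly singular if for every closed infinite-dimensional subspace $Z$ of $X$ the restriction $A|_Z$ is not an isomorphism (onto its image). Hybrid-type: $A$ (and the equation $Ax=y$) is of hybrid-type if $A$ is strictly singular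 and $\mathcal{R}(A)$ contains an infinite-dimensional closed subspace of $Y$. *)

theory Defs
  imports "HOL-Analysis.Analysis"
begin

section \<open>The real sequence spaces\<close>

text \<open>Sequences are indexed from \<open>0\<close>: the entry with index \<open>k\<close> here is the entry
  with index \<open>k + 1\<close> in the convention that the natural numbers start at \<open>1\<close>.\<close>

subsection \<open>Absolutely summable sequences\<close>

typedef ell1 = "{x :: nat \<Rightarrow> real. summable (\<lambda>k. \<bar>x k\<bar>)}"
  morphisms ell1_nth Abs_ell1
  by (rule exI[of _ "\<lambda>_. 0"]) simp

setup_lifting type_definition_ell1

lemma ell1_eqI: "(\<And>k. ell1_nth x k = ell1_nth y k) \<Longrightarrow> x = y"
  by transfer auto

lemma summable_ell1: "summable (\<lambda>k. \<bar>ell1_nth x k\<bar>)"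
  by transfer auto

instantiation ell1 :: real_normed_vector
begin

lift_definition zero_ell1 :: ell1 is "\<lambda>_. 0" by simp

lift_definition plus_ell1 :: "ell1 \<Rightarrow> ell1 \<Rightarrow> ell1" is "\<lambda>x y k. x k + y k"
proof -
  fix x y :: "nat \<Rightarrow> real"
  assume "summable (\<lambda>k. \<bar>x k\<bar>)" "summable (\<lambda>k. \<bar>y k\<bar>)"
  then have "summable (\<lambda>k. \<bar>x k\<bar> + \<bar>y k\<bar>)" by (rule summable_add)
  then show "summable (\<lambda>k. \<bar>x k + y k\<bar>)"
    by (rule summable_comparison_test'[where N = 0]) (simp add: abs_triangle_ineq)
qed

lift_definition uminus_ell1 :: "ell1 \<Rightarrow> ell1" is "\<lambda>x k. - x k" by simp

lift_definition minus_ell1 :: "ell1 \<Rightarrow> ell1 \<Rightarrow> ell1" is "\<lambda>x y k. x k - y k"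
proof -
  fix x y :: "nat \<Rightarrow> real"
  assume "summable (\<lambda>k. \<bar>x k\<bar>)" "summable (\<lambda>k. \<bar>y k\<bar>)"
  then have "summable (\<lambda>k. \<bar>x k\<bar> + \<bar>y k\<bar>)" by (rule summable_add)
  then show "summable (\<lambda>k. \<bar>x k - y k\<bar>)"
    by (rule summable_comparison_test'[where N = 0]) (simp add: abs_triangle_ineq4)
qed

lift_definition scaleR_ell1 :: "real \<Rightarrow> ell1 \<Rightarrow> ell1" is "\<lambda>r x k. r * x k"
  by (simp add: abs_mult summable_mult)

lift_definition norm_ell1 :: "ell1 \<Rightarrow> real" is "\<lambda>x. \<Sum>k. \<bar>x k\<bar>" .

definition dist_ell1 :: "ell1 \<Rightarrow> ell1 \<Rightarrow> real" where "dist_ell1 x y = norm (x - y)"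

definition sgn_ell1 :: "ell1 \<Rightarrow> ell1" where "sgn_ell1 x = inverse (norm x) *\<^sub>R x"

definition uniformity_ell1 :: "(ell1 \<times> ell1) filter"
  where "uniformity_ell1 = (INF e\<in>{0 <..}. principal {(x, y). dist x y < e})"

definition open_ell1 :: "ell1 set \<Rightarrow> bool"
  where "open_ell1 S = (\<forall>x\<in>S. \<forall>\<^sub>F (x', y) in uniformity. x' = x \<longrightarrow> y \<in> S)"

instance
proof
  fix x y :: ell1 and r :: real
  show "norm x = 0 \<longleftrightarrow> x = 0"
    by transfer (auto simp: suminf_eq_zero_iff)
  show "norm (x + y) \<le> norm x + norm y"
  proof transfer
    fix x y :: "nat \<Rightarrow> real"
    assume s: "summable (\<lambda>k. \<bar>x k\<bar>)" "summable (\<lambda>k. \<bar>y k\<bar>)"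
    then have s': "summable (\<lambda>k. \<bar>x k\<bar> + \<bar>y k\<bar>)" by (rule summable_add)
    then have "summable (\<lambda>k. \<bar>x k + y k\<bar>)"
      by (rule summable_comparison_test'[where N = 0]) (simp add: abs_triangle_ineq)
    then have "(\<Sum>k. \<bar>x k + y k\<bar>) \<le> (\<Sum>k. \<bar>x k\<bar> + \<bar>y k\<bar>)"
      using s' by (intro suminf_le) (auto simp: abs_triangle_ineq)
    then show "(\<Sum>k. \<bar>x k + y k\<bar>) \<le> (\<Sum>k. \<bar>x k\<bar>) + (\<Sum>k. \<bar>y k\<bar>)"
      using suminf_add[OF s] by simp
  qed
  show "norm (r *\<^sub>R x) = \<bar>r\<bar> * norm x"
    by transfer (simp add: abs_mult suminf_mult)
qed (auto simp: dist_ell1_def sgn_ell1_def uniformity_ell1_def open_ell1_def,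
     (transfer, simp add: algebra_simps fun_eq_iff)+)

end

lemma ell1_nth_simps [simp]:
  "ell1_nth 0 k = 0" "ell1_nth (x + y) k = ell1_nth x k + ell1_nth y k"
  "ell1_nth (x - y) k = ell1_nth x k - ell1_nth y k" "ell1_nth (- x) k = - ell1_nth x k"
  "ell1_nth (r *\<^sub>R x) k = r * ell1_nth x k"
  by (transfer, simp)+

lemma sum_le_norm_ell1: "(\<Sum>k<n. \<bar>ell1_nth x k\<bar>) \<le> norm x"
  by transfer (simp add: sum_le_suminf)

lemma abs_ell1_nth_le_norm: "\<bar>ell1_nth x k\<bar> \<le> norm x"
proof -
  have "\<bar>ell1_nth x k\<bar> \<le> (\<Sum>j<Suc k. \<bar>ell1_nth x j\<bar>)"
    by (rule member_le_sum) auto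
  then show ?thesis using sum_le_norm_ell1 order_trans by blast
qed

instance ell1 :: banach
proof
  fix X :: "nat \<Rightarrow> ell1"
  assume C: "Cauchy X"
  have "Cauchy (\<lambda>n. ell1_nth (X n) k)" for k
  proof (rule metric_CauchyI)
    fix e :: real assume "e > 0"
    then obtain N where N: "\<And>m n. m \<ge> N \<Longrightarrow> n \<ge> N \<Longrightarrow> dist (X m) (X n) < e"
      using metric_CauchyD[OF C] by blast
    have "dist (ell1_nth (X m) k) (ell1_nth (X n) k) \<le> dist (X m) (X n)" for m n
      using abs_ell1_nth_le_norm[of "X m - X n" k] by (simp add: dist_norm)
    then show "\<exists>M. \<forall>m\<ge>M. \<forall>n\<ge>M. dist (ell1_nth (X m) k) (ell1_nth (X n) k) < e"
      using N by (meson le_less_trans)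
  qed
  then have "\<exists>l. (\<lambda>n. ell1_nth (X n) k) \<longlonglongrightarrow> l" for k
    using Cauchy_convergent convergent_def by blast
  then obtain l where l: "\<And>k. (\<lambda>n. ell1_nth (X n) k) \<longlonglongrightarrow> l k" by metis
  have bound: "(\<Sum>k<K. \<bar>ell1_nth (X m) k - l k\<bar>) \<le> e"
    if N: "\<And>m n. m \<ge> N \<Longrightarrow> n \<ge> N \<Longrightarrow> dist (X m) (X n) < e" and "m \<ge> N" for e N m K
  proof (rule LIMSEQ_le_const2)
    show "(\<lambda>n. \<Sum>k<K. \<bar>ell1_nth (X m) k - ell1_nth (X n) k\<bar>)
        \<longlonglongrightarrow> (\<Sum>k<K. \<bar>ell1_nth (X m) k - l k\<bar>)"
      by (intro tendsto_intros l)
    have "(\<Sum>k<K. \<bar>ell1_nth (X m) k - ell1_nth (X n) k\<bar>) \<le> e" if "n \<ge> N" for n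
      using sum_le_norm_ell1[of "X m - X n" K] N[OF \<open>m \<ge> N\<close> that] by (simp add: dist_norm)
    then show "\<exists>N. \<forall>n\<ge>N. (\<Sum>k<K. \<bar>ell1_nth (X m) k - ell1_nth (X n) k\<bar>) \<le> e" by blast
  qed
  obtain N1 where N1: "\<And>m n. m \<ge> N1 \<Longrightarrow> n \<ge> N1 \<Longrightarrow> dist (X m) (X n) < 1"
    using metric_CauchyD[OF C, of 1] by auto
  have "summable (\<lambda>k. \<bar>ell1_nth (X N1) k - l k\<bar>)"
    by (rule bounded_imp_summable[where B = 1])
      (use bound[OF N1, of N1] in \<open>auto simp: lessThan_Suc_atMost[symmetric] simp del: sum.lessThan_Suc\<close>)
  then have "summable (\<lambda>k. \<bar>ell1_nth (X N1) k\<bar> + \<bar>ell1_nth (X N1) k - l k\<bar>)"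
    by (intro summable_add summable_ell1)
  then have "summable (\<lambda>k. \<bar>l k\<bar>)"
    by (rule summable_comparison_test'[where N = 0]) auto
  then obtain L where L: "ell1_nth L = l"
    using Abs_ell1_inverse by blast
  have "X \<longlonglongrightarrow> L"
  proof (rule metric_LIMSEQ_I)
    fix e :: real assume "e > 0"
    then obtain N where N: "\<And>m n. m \<ge> N \<Longrightarrow> n \<ge> N \<Longrightarrow> dist (X m) (X n) < e / 2"
      using metric_CauchyD[OF C, of "e / 2"] by auto
    have "dist (X m) L < e" if "m \<ge> N" for m
    proof -
      have "norm (X m - L) = (\<Sum>k. \<bar>ell1_nth (X m - L) k\<bar>)" by (simp add: norm_ell1.rep_eq)
      also have "\<dots> \<le> e / 2"
        using bound[OF N that] by (intro suminf_le_const summable_ell1) (auto simp: L)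
      finally show ?thesis using \<open>e > 0\<close> by (simp add: dist_norm)
    qed
    then show "\<exists>N. \<forall>n\<ge>N. dist (X n) L < e" by blast
  qed
  then show "convergent X" by (rule convergentI)
qed


subsection \<open>Square-summable sequences\<close>

typedef ell2 = "{x :: nat \<Rightarrow> real. summable (\<lambda>k. (x k)\<^sup>2)}"
  morphisms ell2_nth Abs_ell2
  by (rule exI[of _ "\<lambda>_. 0"]) simp

setup_lifting type_definition_ell2

lemma summable_mult_ell2:
  fixes x y :: "nat \<Rightarrow> real"
  assumes "summable (\<lambda>k. (x k)\<^sup>2)" "summable (\<lambda>k. (y k)\<^sup>2)"
  shows "summable (\<lambda>k. x k * y k)"
proof (rule summable_comparison_test'[where N = 0])
  show "summable (\<lambda>k. (x k)\<^sup>2 + (y k)\<^sup>2)" by (intro summable_add assms)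
  fix k
  have "2 * (\<bar>x k\<bar> * \<bar>y k\<bar>) \<le> (x k)\<^sup>2 + (y k)\<^sup>2"
    using sum_squares_bound[of "\<bar>x k\<bar>" "\<bar>y k\<bar>"] by simp
  moreover have "0 \<le> \<bar>x k\<bar> * \<bar>y k\<bar>" by simp
  ultimately show "norm (x k * y k) \<le> (x k)\<^sup>2 + (y k)\<^sup>2"
    unfolding real_norm_def abs_mult by linarith
qed

lemma summable_add_ell2:
  fixes x y :: "nat \<Rightarrow> real"
  assumes "summable (\<lambda>k. (x k)\<^sup>2)" "summable (\<lambda>k. (y k)\<^sup>2)"
  shows "summable (\<lambda>k. (x k + y k)\<^sup>2)"
  unfolding power2_sum
  by (intro summable_add assms) (simp add: mult.assoc summable_mult summable_mult_ell2 assms)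

lemma ell2_eqI: "(\<And>k. ell2_nth x k = ell2_nth y k) \<Longrightarrow> x = y"
  by transfer auto

lemma summable_ell2: "summable (\<lambda>k. (ell2_nth x k)\<^sup>2)"
  by transfer auto

instantiation ell2 :: real_inner
begin

lift_definition zero_ell2 :: ell2 is "\<lambda>_. 0" by simp

lift_definition plus_ell2 :: "ell2 \<Rightarrow> ell2 \<Rightarrow> ell2" is "\<lambda>x y k. x k + y k"
  by (rule summable_add_ell2)

lift_definition uminus_ell2 :: "ell2 \<Rightarrow> ell2" is "\<lambda>x k. - x k" by simp

lift_definition minus_ell2 :: "ell2 \<Rightarrow> ell2 \<Rightarrow> ell2" is "\<lambda>x y k. x k - y k"
proof -
  fix x y :: "nat \<Rightarrow> real"
  assume "summable (\<lambda>k. (x k)\<^sup>2)" "summable (\<lambda>k. (y k)\<^sup>2)"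
  then show "summable (\<lambda>k. (x k - y k)\<^sup>2)"
    using summable_add_ell2[of x "\<lambda>k. - y k"] by simp
qed

lift_definition scaleR_ell2 :: "real \<Rightarrow> ell2 \<Rightarrow> ell2" is "\<lambda>r x k. r * x k"
  by (simp add: power_mult_distrib summable_mult)

lift_definition inner_ell2 :: "ell2 \<Rightarrow> ell2 \<Rightarrow> real" is "\<lambda>x y. \<Sum>k. x k * y k" .

lift_definition norm_ell2 :: "ell2 \<Rightarrow> real" is "\<lambda>x. sqrt (\<Sum>k. (x k)\<^sup>2)" .

definition dist_ell2 :: "ell2 \<Rightarrow> ell2 \<Rightarrow> real" where "dist_ell2 x y = norm (x - y)"

definition sgn_ell2 :: "ell2 \<Rightarrow> ell2" where "sgn_ell2 x = inverse (norm x) *\<^sub>R x"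

definition uniformity_ell2 :: "(ell2 \<times> ell2) filter"
  where "uniformity_ell2 = (INF e\<in>{0 <..}. principal {(x, y). dist x y < e})"

definition open_ell2 :: "ell2 set \<Rightarrow> bool"
  where "open_ell2 S = (\<forall>x\<in>S. \<forall>\<^sub>F (x', y) in uniformity. x' = x \<longrightarrow> y \<in> S)"

instance
proof
  fix x y z :: ell2 and r :: real
  show "inner x y = inner y x"
    by transfer (simp add: mult.commute)
  show "inner (x + y) z = inner x z + inner y z"
    by transfer (simp add: distrib_right suminf_add summable_mult_ell2)
  show "inner (r *\<^sub>R x) y = r * inner x y"
    by transfer (simp add: mult.assoc suminf_mult summable_mult_ell2)
  show "0 \<le> inner x x"
    by transfer (simp add: suminf_nonneg power2_eq_square)
  show "inner x x = 0 \<longleftrightarrow> x = 0"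
    by transfer (auto simp: suminf_eq_zero_iff power2_eq_square)
  show "norm x = sqrt (inner x x)"
    by transfer (simp add: power2_eq_square)
qed (auto simp: dist_ell2_def sgn_ell2_def uniformity_ell2_def open_ell2_def,
     (transfer, simp add: algebra_simps fun_eq_iff)+)

end

lemma ell2_nth_simps [simp]:
  "ell2_nth 0 k = 0" "ell2_nth (x + y) k = ell2_nth x k + ell2_nth y k"
  "ell2_nth (x - y) k = ell2_nth x k - ell2_nth y k" "ell2_nth (- x) k = - ell2_nth x k"
  "ell2_nth (r *\<^sub>R x) k = r * ell2_nth x k"
  by (transfer, simp)+

lemma sum_le_norm_ell2: "(\<Sum>k<n. (ell2_nth x k)\<^sup>2) \<le> (norm x)\<^sup>2"
  by transfer (simp add: sum_le_suminf suminf_nonneg)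

lemma abs_ell2_nth_le_norm: "\<bar>ell2_nth x k\<bar> \<le> norm x"
proof -
  have "(ell2_nth x k)\<^sup>2 \<le> (\<Sum>j<Suc k. (ell2_nth x j)\<^sup>2)"
    by (rule member_le_sum) auto
  then have "(ell2_nth x k)\<^sup>2 \<le> (norm x)\<^sup>2" using sum_le_norm_ell2 order_trans by blast
  then show ?thesis by (intro power2_le_imp_le[of "\<bar>ell2_nth x k\<bar>" "norm x"]) simp_all
qed

instance ell2 :: banach
proof
  fix X :: "nat \<Rightarrow> ell2"
  assume C: "Cauchy X"
  have "Cauchy (\<lambda>n. ell2_nth (X n) k)" for k
  proof (rule metric_CauchyI)
    fix e :: real assume "e > 0"
    then obtain N where N: "\<And>m n. m \<ge> N \<Longrightarrow> n \<ge> N \<Longrightarrow> dist (X m) (X n) < e"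
      using metric_CauchyD[OF C] by blast
    have "dist (ell2_nth (X m) k) (ell2_nth (X n) k) \<le> dist (X m) (X n)" for m n
      using abs_ell2_nth_le_norm[of "X m - X n" k] by (simp add: dist_norm)
    then show "\<exists>M. \<forall>m\<ge>M. \<forall>n\<ge>M. dist (ell2_nth (X m) k) (ell2_nth (X n) k) < e"
      using N by (meson le_less_trans)
  qed
  then have "\<exists>l. (\<lambda>n. ell2_nth (X n) k) \<longlonglongrightarrow> l" for k
    using Cauchy_convergent convergent_def by blast
  then obtain l where l: "\<And>k. (\<lambda>n. ell2_nth (X n) k) \<longlonglongrightarrow> l k" by metis
  have bound: "(\<Sum>k<K. (ell2_nth (X m) k - l k)\<^sup>2) \<le> e\<^sup>2"
    if N: "\<And>m n. m \<ge> N \<Longrightarrow> n \<ge> N \<Longrightarrow> dist (X m) (X n) < e" and "m \<ge> N" for e N m K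
  proof (rule LIMSEQ_le_const2)
    show "(\<lambda>n. \<Sum>k<K. (ell2_nth (X m) k - ell2_nth (X n) k)\<^sup>2)
        \<longlonglongrightarrow> (\<Sum>k<K. (ell2_nth (X m) k - l k)\<^sup>2)"
      by (intro tendsto_intros l)
    have "(\<Sum>k<K. (ell2_nth (X m) k - ell2_nth (X n) k)\<^sup>2) \<le> e\<^sup>2" if "n \<ge> N" for n
    proof -
      have "(norm (X m - X n))\<^sup>2 \<le> e\<^sup>2"
        using N[OF \<open>m \<ge> N\<close> that] by (intro power_mono) (auto simp: dist_norm)
      then show ?thesis using sum_le_norm_ell2[of "X m - X n" K] by simp
    qed
    then show "\<exists>N. \<forall>n\<ge>N. (\<Sum>k<K. (ell2_nth (X m) k - ell2_nth (X n) k)\<^sup>2) \<le> e\<^sup>2" by blast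
  qed
  obtain N1 where N1: "\<And>m n. m \<ge> N1 \<Longrightarrow> n \<ge> N1 \<Longrightarrow> dist (X m) (X n) < 1"
    using metric_CauchyD[OF C, of 1] by auto
  have "summable (\<lambda>k. (ell2_nth (X N1) k - l k)\<^sup>2)"
    by (rule bounded_imp_summable[where B = 1])
      (use bound[OF N1, of N1] in \<open>auto simp: lessThan_Suc_atMost[symmetric] simp del: sum.lessThan_Suc\<close>)
  then have "summable (\<lambda>k. (ell2_nth (X N1) k + - (ell2_nth (X N1) k - l k))\<^sup>2)"
    by (intro summable_add_ell2 summable_ell2) (simp add: power2_commute)
  then have "summable (\<lambda>k. (l k)\<^sup>2)" by simp
  then obtain L where L: "ell2_nth L = l"
    using Abs_ell2_inverse by blast
  have "X \<longlonglongrightarrow> L"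
  proof (rule metric_LIMSEQ_I)
    fix e :: real assume "e > 0"
    then obtain N where N: "\<And>m n. m \<ge> N \<Longrightarrow> n \<ge> N \<Longrightarrow> dist (X m) (X n) < e / 2"
      using metric_CauchyD[OF C, of "e / 2"] by auto
    have "dist (X m) L < e" if "m \<ge> N" for m
    proof -
      have "norm (X m - L) = sqrt (\<Sum>k. (ell2_nth (X m - L) k)\<^sup>2)" by (simp add: norm_ell2.rep_eq)
      also have "\<dots> \<le> sqrt ((e / 2)\<^sup>2)"
        using bound[OF N that]
        by (intro real_sqrt_le_mono suminf_le_const summable_ell2) (auto simp: L)
      also have "\<dots> = e / 2" using \<open>e > 0\<close> by simp
      finally show ?thesis using \<open>e > 0\<close> by (simp add: dist_norm)
    qed
    then show "\<exists>N. \<forall>n\<ge>N. dist (X n) L < e" by blast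
  qed
  then show "convergent X" by (rule convergentI)
qed


subsection \<open>Bounded sequences\<close>

text \<open>The type \<open>nat\<close> carries the discrete topology, so continuity is no restriction here;
  the norm of bounded continuous functions is the supremum norm. The library proves
  completeness only for a metric domain, whence the metric on \<open>nat\<close>; it induces the
  topology \<open>nat\<close> already has.\<close>

instantiation nat :: metric_space
begin

definition dist_nat :: "nat \<Rightarrow> nat \<Rightarrow> real" where "dist_nat m n = \<bar>real m - real n\<bar>"

definition uniformity_nat :: "(nat \<times> nat) filter"
  where "uniformity_nat = (INF e\<in>{0 <..}. principal {(x, y). dist x y < e})"

instance
proof
  fix S :: "nat set"
  have "{(m, n). dist m n < (1::real)} = {(m, n :: nat). m = n}"
    by (auto simp: dist_nat_def abs_less_iff)
  then have "(uniformity :: (nat \<times> nat) filter) \<le> principal {(m, n). m = n}"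
    unfolding uniformity_nat_def by (intro INF_lower2[of 1]) auto
  then have "\<forall>\<^sub>F (m, n) in (uniformity :: (nat \<times> nat) filter). m = n"
    by (simp add: le_principal case_prod_unfold)
  then have "\<forall>\<^sub>F (m, n) in uniformity. m = x \<longrightarrow> n \<in> S" if "x \<in> S" for x
    by (rule eventually_mono) (use that in auto)
  then show "open S \<longleftrightarrow> (\<forall>x\<in>S. \<forall>\<^sub>F (x', y) in uniformity. x' = x \<longrightarrow> y \<in> S)"
    by (auto simp: open_discrete)
qed (auto simp: dist_nat_def uniformity_nat_def)

end

instance bcontfun :: (metric_space, banach) banach ..

type_synonym ell_infty = "nat \<Rightarrow>\<^sub>C real"


section \<open>Subspaces\<close>

definition closed_subspace :: "'a::real_normed_vector set \<Rightarrow> bool"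
  where "closed_subspace S \<longleftrightarrow> subspace S \<and> closed S"

definition finite_dim :: "'a::real_vector set \<Rightarrow> bool"
  where "finite_dim S \<longleftrightarrow> (\<exists>E. finite E \<and> independent E \<and> span E = S)"

definition quotient_space :: "'a::real_vector set \<Rightarrow> 'a set set"
  where "quotient_space N = range (\<lambda>x. {x} + N)"

text \<open>The quotient by \<open>N\<close> is spanned by a finite set \<open>F\<close> of cosets. Sums of sets are elementwise.
  The linear combination of cosets \<open>D\<close> with coefficients \<open>c D\<close> is the set in the formula;
  the summand \<open>N\<close> makes it a coset also if \<open>F\<close> is empty or all coefficients vanish.\<close>

definition finite_codim :: "'a::real_vector set \<Rightarrow> bool"
  where "finite_codim N \<longleftrightarrow>
    (\<exists>F. finite F \<and> F \<subseteq> quotient_space N \<and>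
      (\<forall>C\<in>quotient_space N. \<exists>c::'a set \<Rightarrow> real. C = N + (\<Sum>D\<in>F. (\<lambda>v. c D *\<^sub>R v) ` D)))"

definition complemented :: "'a::real_normed_vector set \<Rightarrow> bool"
  where "complemented N \<longleftrightarrow> closed_subspace N \<and>
    (\<exists>U. closed_subspace U \<and> N + U = UNIV \<and> N \<inter> U = {0})"

definition uncomplemented :: "'a::real_normed_vector set \<Rightarrow> bool"
  where "uncomplemented N \<longleftrightarrow> closed_subspace N \<and> \<not> complemented N"


section \<open>Bounded linear operators and operator equations\<close>

definition null_space :: "('a::real_normed_vector \<Rightarrow>\<^sub>L 'b::real_normed_vector) \<Rightarrow> 'a set"
  where "null_space A = {x. A x = 0}"

abbreviation op_range :: "('a::real_normed_vector \<Rightarrow>\<^sub>L 'b::real_normed_vector) \<Rightarrow> 'b set"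
  where "op_range A \<equiv> range (blinfun_apply A)"

text \<open>The predicates below concern the equation \<open>A x = y\<close> and are meant for
  infinite-dimensional Banach spaces.\<close>

definition well_posed :: "('a::banach \<Rightarrow>\<^sub>L 'b::banach) \<Rightarrow> bool"
  where "well_posed A \<longleftrightarrow> closed (op_range A) \<and> complemented (null_space A)"

abbreviation ill_posed :: "('a::banach \<Rightarrow>\<^sub>L 'b::banach) \<Rightarrow> bool"
  where "ill_posed A \<equiv> \<not> well_posed A"

definition range_contains_infinite_dim :: "('a::banach \<Rightarrow>\<^sub>L 'b::banach) \<Rightarrow> bool"
  where "range_contains_infinite_dim A \<longleftrightarrow>
    (\<exists>M. closed_subspace M \<and> \<not> finite_dim M \<and> M \<subseteq> op_range A)"

definition ill_posed_type_I :: "('a::banach \<Rightarrow>\<^sub>L 'b::banach) \<Rightarrow> bool"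
  where "ill_posed_type_I A \<longleftrightarrow> ill_posed A \<and> range_contains_infinite_dim A"

text \<open>The restriction to a subspace \<open>Z\<close> is an isomorphism onto its image iff it is a
  homeomorphism onto its image, the inverse of a linear bijection being linear.\<close>

definition strictly_singular :: "('a::banach \<Rightarrow>\<^sub>L 'b::banach) \<Rightarrow> bool"
  where "strictly_singular A \<longleftrightarrow>
    (\<forall>Z. closed_subspace Z \<and> \<not> finite_dim Z \<longrightarrow>
      \<not> (\<exists>g. homeomorphism Z (blinfun_apply A ` Z) (blinfun_apply A) g))"

definition hybrid_type :: "('a::banach \<Rightarrow>\<^sub>L 'b::banach) \<Rightarrow> bool"
  where "hybrid_type A \<longleftrightarrow> strictly_singular A \<and> range_contains_infinite_dim A"


section \<open>Duality\<close>

definition annihilator :: "ell1 set \<Rightarrow> ell_infty set"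
  where "annihilator N = {\<xi>. \<forall>x\<in>N. (\<Sum>k. apply_bcontfun \<xi> k * ell1_nth x k) = 0}"

definition adjoint_op :: "(ell1 \<Rightarrow>\<^sub>L ell2) \<Rightarrow> (ell2 \<Rightarrow>\<^sub>L ell_infty)"
  where "adjoint_op B =
    (THE T :: ell2 \<Rightarrow>\<^sub>L ell_infty.
      \<forall>\<eta> x. inner \<eta> (B x) = (\<Sum>k. apply_bcontfun (T \<eta>) k * ell1_nth x k))"

lift_definition ell1_unit :: "nat \<Rightarrow> ell1" is "\<lambda>i k. if k = i then 1 else 0"
proof -
  fix i
  show "summable (\<lambda>k. \<bar>if k = i then 1 else 0 :: real\<bar>)"
    by (rule summable_finite[of "{i}"]) auto
qed

lemma norm_ell1_unit: "norm (ell1_unit i) = 1"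
proof transfer
  fix i
  have "(\<Sum>k. \<bar>if k = i then 1 else 0 :: real\<bar>) = (\<Sum>k\<in>{i}. \<bar>if k = i then 1 else 0 :: real\<bar>)"
    by (rule suminf_finite) auto
  then show "(\<Sum>k. \<bar>if k = i then 1 else 0 :: real\<bar>) = 1" by simp
qed

lemma suminf_mult_ell1_unit: "(\<Sum>k. f k * ell1_nth (ell1_unit i) k) = f i"
proof -
  have "(\<Sum>k. f k * ell1_nth (ell1_unit i) k) = (\<Sum>k\<in>{i}. f k * ell1_nth (ell1_unit i) k)"
    by (rule suminf_finite) (auto simp: ell1_unit.rep_eq)
  then show ?thesis by (simp add: ell1_unit.rep_eq)
qed

lemma ell1_nth_sum: "ell1_nth (\<Sum>i\<in>I. f i) k = (\<Sum>i\<in>I. ell1_nth (f i) k)"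
  by (induction I rule: infinite_finite_induct) auto

lemma ell1_expansion: "(\<lambda>k. ell1_nth x k *\<^sub>R ell1_unit k) sums x"
proof -
  have eq: "norm (x - (\<Sum>i<n. ell1_nth x i *\<^sub>R ell1_unit i))
      = (\<Sum>k. \<bar>ell1_nth x (k + n)\<bar>)" (is "norm ?d = _") for n
  proof -
    have d: "ell1_nth ?d k = (if k < n then 0 else ell1_nth x k)" for k
    proof -
      have "(\<Sum>i<n. ell1_nth x i * ell1_nth (ell1_unit i) k)
          = (\<Sum>i<n. if i = k then ell1_nth x k else 0)"
        by (intro sum.cong) (auto simp: ell1_unit.rep_eq)
      then show ?thesis by (simp add: ell1_nth_sum)
    qed
    have "norm ?d = (\<Sum>k. \<bar>ell1_nth ?d k\<bar>)" by (simp add: norm_ell1.rep_eq)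
    also have "\<dots> = (\<Sum>k. \<bar>ell1_nth ?d (k + n)\<bar>) + (\<Sum>k<n. \<bar>ell1_nth ?d k\<bar>)"
      by (rule suminf_split_initial_segment) (rule summable_ell1)
    also have "\<dots> = (\<Sum>k. \<bar>ell1_nth x (k + n)\<bar>)" unfolding d by simp
    finally show ?thesis .
  qed
  have "(\<lambda>n. \<Sum>k. \<bar>ell1_nth x (k + n)\<bar>) \<longlonglongrightarrow> 0"
    by (rule suminf_exist_split2[OF summable_ell1])
  then have "(\<lambda>n. norm (x - (\<Sum>i<n. ell1_nth x i *\<^sub>R ell1_unit i))) \<longlonglongrightarrow> 0"
    unfolding eq .
  then have "(\<lambda>n. (\<Sum>i<n. ell1_nth x i *\<^sub>R ell1_unit i) - x) \<longlonglongrightarrow> 0"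
    by (subst (asm) norm_minus_commute) (simp add: tendsto_norm_zero_iff)
  then show ?thesis unfolding sums_def by (simp add: LIM_zero_iff)
qed

lemma adjoint_op_unique_existence:
  fixes B :: "ell1 \<Rightarrow>\<^sub>L ell2"
  shows "\<exists>!T :: ell2 \<Rightarrow>\<^sub>L ell_infty.
    \<forall>\<eta> x. inner \<eta> (B x) = (\<Sum>k. apply_bcontfun (T \<eta>) k * ell1_nth x k)"
proof (rule ex_ex1I)
  let ?f = "\<lambda>\<eta> k. inner \<eta> (B (ell1_unit k))"
  have bd: "\<bar>?f \<eta> k\<bar> \<le> norm \<eta> * norm B" for \<eta> k
  proof -
    have "\<bar>?f \<eta> k\<bar> \<le> norm \<eta> * norm (B (ell1_unit k))" by (rule Cauchy_Schwarz_ineq2)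
    also have "norm (B (ell1_unit k)) \<le> norm B * norm (ell1_unit k)" by (rule norm_blinfun)
    finally show ?thesis by (simp add: norm_ell1_unit mult_left_mono)
  qed
  define T where "T = (\<lambda>\<eta>. Bcontfun (?f \<eta>))"
  have T: "apply_bcontfun (T \<eta>) = ?f \<eta>" for \<eta>
  proof -
    have "?f \<eta> \<in> bcontfun"
      unfolding bcontfun_def bounded_iff using bd by (auto intro!: exI[of _ "norm \<eta> * norm B"])
    then show ?thesis unfolding T_def by (rule Bcontfun_inverse)
  qed
  have "bounded_linear T"
  proof (rule bounded_linear_intro)
    show "T (x + y) = T x + T y" for x y
      by (rule bcontfun_eqI) (simp add: T inner_add_left)
    show "T (r *\<^sub>R x) = r *\<^sub>R T x" for r x
      by (rule bcontfun_eqI) (simp add: T)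
    show "norm (T x) \<le> norm x * norm B" for x
      by (rule norm_bound) (use bd in \<open>simp add: T\<close>)
  qed
  then have bT: "blinfun_apply (Blinfun T) = T" by (rule bounded_linear_Blinfun_apply)
  have "inner \<eta> (B x) = (\<Sum>k. apply_bcontfun (Blinfun T \<eta>) k * ell1_nth x k)" for \<eta> x
  proof -
    have "(\<lambda>k. inner \<eta> (B (ell1_nth x k *\<^sub>R ell1_unit k))) sums inner \<eta> (B x)"
      using bounded_linear.sums[OF bounded_linear_inner_right
          bounded_linear.sums[OF blinfun.bounded_linear_right ell1_expansion]] .
    then have "(\<lambda>k. apply_bcontfun (Blinfun T \<eta>) k * ell1_nth x k) sums inner \<eta> (B x)"
      by (simp add: bT T blinfun.scaleR_right mult.commute)
    then show ?thesis by (simp add: sums_iff)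
  qed
  then show "\<exists>T :: ell2 \<Rightarrow>\<^sub>L ell_infty.
      \<forall>\<eta> x. inner \<eta> (B x) = (\<Sum>k. apply_bcontfun (T \<eta>) k * ell1_nth x k)"
    by blast
next
  fix S T :: "ell2 \<Rightarrow>\<^sub>L ell_infty"
  assume "\<forall>\<eta> x. inner \<eta> (B x) = (\<Sum>k. apply_bcontfun (S \<eta>) k * ell1_nth x k)"
    and "\<forall>\<eta> x. inner \<eta> (B x) = (\<Sum>k. apply_bcontfun (T \<eta>) k * ell1_nth x k)"
  then have "apply_bcontfun (S \<eta>) k = apply_bcontfun (T \<eta>) k" for \<eta> k
    by (metis suminf_mult_ell1_unit)
  then show "S = T" by (intro blinfun_eqI bcontfun_eqI)
qed

lemma adjoint_op:
  fixes B :: "ell1 \<Rightarrow>\<^sub>L ell2"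
  shows "inner \<eta> (B x) = (\<Sum>k. apply_bcontfun (adjoint_op B \<eta>) k * ell1_nth x k)"
  using theI'[OF adjoint_op_unique_existence[of B]] unfolding adjoint_op_def by blast


section \<open>Operators of Mazur type\<close>

definition mazur_type :: "(ell1 \<Rightarrow>\<^sub>L ell2) \<Rightarrow> (nat \<Rightarrow> ell2) \<Rightarrow> bool"
  where "mazur_type B \<zeta> \<longleftrightarrow>
    inj \<zeta> \<and> range \<zeta> \<subseteq> sphere 0 1 \<and> sphere 0 1 \<subseteq> closure (range \<zeta>) \<and>
    (\<forall>x. (\<lambda>k. ell1_nth x k *\<^sub>R \<zeta> k) sums B x)"

end

theory Submission
  imports Defs
begin

text \<open>
  Two opposing facts carry the theorem. On the one hand, the open mapping theorem makes a
  surjection \<open>B\<close> from \<open>\<ell>\<^sup>1\<close> onto \<open>\<ell>\<^sup>2\<close> a quotient map: every \<open>y\<close> has a preimage of norm at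
  most \<open>C\<cdot>\<parallel>y\<parallel>\<close>. On the other hand, the geometries of the two norms are incompatible on infinite-dimensional
  subspaces: an infinite-dimensional subspace of \<open>\<ell>\<^sup>1\<close> contains unit vectors that are almost
  disjointly supported, so a signed sum of \<open>n\<close> of them has norm of order \<open>n\<close> whatever the signs,
  whereas in a Hilbert space the signs can be chosen so that the sum of the images has norm of order at most
  \<open>\<surd>n\<close> (lemma \<open>signed_sums\<close>). Hence no bounded operator from \<open>\<ell>\<^sup>1\<close> to \<open>\<ell>\<^sup>2\<close> is bounded below on an
  infinite-dimensional subspace (\<open>not_bounded_below_ell1_ell2\<close>), which is strict singularity.

  The facts on the null space follow from this clash. On a closed complement \<open>U\<close> of the null space,
  \<open>B\<close> would be a bijection onto \<open>\<ell>\<^sup>2\<close>, hence bounded below by the open mapping theorem, while \<open>U\<close> has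
  infinite dimension because its image does. The null space is therefore uncomplemented, and it has
  infinite dimension because finite-dimensional subspaces of \<open>\<ell>\<^sup>1\<close> are complemented
  (\<open>finite_span_complement_ell1\<close>). Its codimension is infinite because the quotient is
  mapped onto \<open>\<ell>\<^sup>2\<close>.

  The adjoint has the entries \<open>\<langle>\<eta>, B e\<^sub>k\<rangle>\<close>, where \<open>e\<^sub>k\<close> are the unit vectors. Testing it
  on a preimage of \<open>\<eta>\<close> of norm at most \<open>C\<cdot>\<parallel>\<eta>\<parallel>\<close> shows that it is bounded below, which makes it
  an isomorphism onto a closed range. A sequence that annihilates the null space factors through \<open>B\<close> as a
  bounded functional on \<open>\<ell>\<^sup>2\<close>; the vector that represents this functional is mapped to the sequence
  by the adjoint.
\<close>

section \<open>Finite-dimensional subspaces\<close>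

lemma finite_dim_iff_finite_span:
  fixes S :: "'a::real_vector set"
  shows "finite_dim S \<longleftrightarrow> (\<exists>E. finite E \<and> span E = S)"
proof
  assume "\<exists>E. finite E \<and> span E = S"
  then obtain E where E: "finite E" "span E = S" by blast
  obtain D where D: "D \<subseteq> E" "independent D" "E \<subseteq> span D"
    using maximal_independent_subset by blast
  then have "span D = span E"
    by (metis span_minimal span_mono subspace_span subset_antisym)
  then show "finite_dim S"
    unfolding finite_dim_def using D E finite_subset by blast
qed (auto simp: finite_dim_def)

text \<open>Passing to the kernel of one functional loses at most one dimension: a basis of the kernel
  and a single vector outside it span the space. Iterated, this makes infinite-dimensional
  subspaces survive finitely many linear constraints.\<close>

lemma finite_dim_if_finite_dim_kernel:
  fixes f :: "'a::real_vector \<Rightarrow> real"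
  assumes S: "subspace S" and f: "linear f" and fin: "finite_dim {x \<in> S. f x = 0}"
  shows "finite_dim S"
proof (cases "\<exists>a\<in>S. f a \<noteq> 0")
  case True
  then obtain a where a: "a \<in> S" "f a \<noteq> 0" by blast
  obtain E where E: "finite E" "span E = {x \<in> S. f x = 0}"
    using fin finite_dim_iff_finite_span by blast
  have "E \<subseteq> S" using E span_superset by blast
  then have "span (insert a E) \<subseteq> S" using a S by (intro span_minimal) auto
  moreover have "x \<in> span (insert a E)" if "x \<in> S" for x
  proof -
    have "x - (f x / f a) *\<^sub>R a \<in> span E"
      unfolding E using S that a
      by (auto intro!: subspace_diff subspace_scale simp: linear_diff[OF f] linear_scale[OF f])
    then show ?thesis using span_insert by blast
  qed
  ultimately show ?thesis using E(1) finite_dim_iff_finite_span by (metis finite_insert subset_antisym subsetI)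
next
  case False
  then have "{x \<in> S. f x = 0} = S" by auto
  then show ?thesis using fin by simp
qed

lemma finite_dim_linear_image:
  assumes "linear f" "finite_dim S"
  shows "finite_dim (f ` S)"
proof -
  obtain E where "finite E" "span E = S" using assms finite_dim_iff_finite_span by blast
  then show ?thesis
    unfolding finite_dim_iff_finite_span using linear_span_image[OF assms(1)] by blast
qed

section \<open>The open mapping theorem\<close>

text \<open>The Baire category argument: the closures of the images of the balls of radius \<open>n\<close> cover the
  complete target space, so one of them contains a ball. Differences of two of its points reach a ball
  around \<open>0\<close>, and scaling gives the estimate for every \<open>y\<close>.\<close>

lemma approximate_preimages:
  fixes f :: "'a::real_normed_vector \<Rightarrow> 'b::banach"
  assumes U: "subspace U" and f: "bounded_linear f" and onto: "f ` U = UNIV"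
  shows "\<exists>C>0. \<forall>y. \<exists>x\<in>U. norm x \<le> C * norm y \<and> norm (y - f x) \<le> norm y / 2"
proof -
  interpret f: bounded_linear f by fact
  let ?G = "range (\<lambda>n. closure (f ` (U \<inter> cball 0 (real n))))"
  have "\<Union>?G = UNIV"
  proof -
    have "y \<in> \<Union>?G" for y
    proof -
      obtain x where x: "x \<in> U" "f x = y" using onto by (metis UNIV_I imageE)
      obtain n where "norm x \<le> real n" using real_arch_simple by blast
      then have "y \<in> f ` (U \<inter> cball 0 (real n))" using x by auto
      then show ?thesis by (intro UnionI[OF rangeI] subsetD[OF closure_subset])
    qed
    then show ?thesis by blast
  qed
  have "\<exists>T\<in>?G. interior T \<noteq> {}"
  proof (rule ccontr)
    assume "\<not> ?thesis"
    then have "euclidean interior_of \<Union>?G = {}"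
      by (intro Baire_category_alt) (auto simp: completely_metrizable_space_euclidean)
    then show False using \<open>\<Union>?G = UNIV\<close> by simp
  qed
  then obtain n y0 where "y0 \<in> interior (closure (f ` (U \<inter> cball 0 (real n))))" by blast
  then obtain r where r: "r > 0" "ball y0 r \<subseteq> closure (f ` (U \<inter> cball 0 (real n)))"
    by (meson mem_interior)
  have near: "\<exists>x\<in>U. norm x \<le> real n \<and> norm (y - f x) < r / 8" if "norm (y - y0) < r" for y
  proof -
    have "y \<in> closure (f ` (U \<inter> cball 0 (real n)))"
      using r that by (auto simp: dist_norm norm_minus_commute)
    then obtain z where "z \<in> f ` (U \<inter> cball 0 (real n))" "dist z y < r / 8"
      using r unfolding closure_approachable by (metis zero_less_divide_iff zero_less_numeral)
    then show ?thesis by (auto simp: dist_norm norm_minus_commute)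
  qed
  have main: "\<exists>x\<in>U. norm x \<le> (4 * real n / r + 1) * norm y \<and> norm (y - f x) \<le> norm y / 2" for y
  proof (cases "y = 0")
    case True
    then show ?thesis using U by (auto intro!: bexI[of _ 0] simp: subspace_0)
  next
    case False
    define t where "t = 2 * norm y / r"
    have t: "t > 0" using False r by (simp add: t_def)
    have ty: "norm (y /\<^sub>R t) = r / 2" using False r by (simp add: t_def)
    obtain x1 where x1: "x1 \<in> U" "norm x1 \<le> real n" "norm (y0 + y /\<^sub>R t - f x1) < r / 8"
      using near[of "y0 + y /\<^sub>R t"] ty r by auto
    obtain x0 where x0: "x0 \<in> U" "norm x0 \<le> real n" "norm (y0 - f x0) < r / 8"
      using near[of y0] r by auto
    let ?x = "t *\<^sub>R (x1 - x0)"
    have "norm (x1 - x0) \<le> 2 * real n" using norm_triangle_ineq4[of x1 x0] x1 x0 by linarith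
    then have "norm ?x \<le> t * (2 * real n)" using t by simp
    also have "\<dots> \<le> (4 * real n / r + 1) * norm y"
      using r by (simp add: t_def field_simps)
    finally have 1: "norm ?x \<le> (4 * real n / r + 1) * norm y" .
    have "y - f ?x = t *\<^sub>R ((y0 + y /\<^sub>R t - f x1) - (y0 - f x0))"
      using t by (simp add: f.scaleR f.diff algebra_simps)
    then have "norm (y - f ?x) = t * norm ((y0 + y /\<^sub>R t - f x1) - (y0 - f x0))" using t by simp
    also have "\<dots> \<le> t * (r / 4)"
      using norm_triangle_ineq4[of "y0 + y /\<^sub>R t - f x1" "y0 - f x0"] x1 x0 t
      by (intro mult_left_mono) auto
    also have "\<dots> = norm y / 2" using r by (simp add: t_def)
    finally have 2: "norm (y - f ?x) \<le> norm y / 2" .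
    have "?x \<in> U" using U x1 x0 by (simp add: subspace_diff subspace_scale)
    then show ?thesis using 1 2 by blast
  qed
  have "4 * real n / r + 1 > 0" using r by (simp add: add_nonneg_pos)
  then show ?thesis using main by blast
qed

text \<open>Completeness of the domain turns approximate preimages into exact ones: the residual is halved in
  each step, so the series of corrections converges absolutely. The result is stated for a closed
  subspace, a set rather than a type, because it is used both for the whole space and for a
  hypothetical complement of a null space.\<close>

lemma open_mapping_bounded_preimages:
  fixes f :: "'a::banach \<Rightarrow> 'b::banach"
  assumes U: "closed_subspace U" and f: "bounded_linear f" and onto: "f ` U = UNIV"
  obtains C where "C > 0" "\<And>y. \<exists>x\<in>U. f x = y \<and> norm x \<le> C * norm y"
proof -
  interpret f: bounded_linear f by fact
  have sub: "subspace U" and "closed U" using U by (auto simp: closed_subspace_def)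
  obtain C where C: "C > 0"
    "\<forall>y. \<exists>x\<in>U. norm x \<le> C * norm y \<and> norm (y - f x) \<le> norm y / 2"
    using approximate_preimages[OF sub f onto] by blast
  then obtain g where g: "\<And>y. g y \<in> U" "\<And>y. norm (g y) \<le> C * norm y"
    "\<And>y. norm (y - f (g y)) \<le> norm y / 2" by metis
  have "\<exists>x\<in>U. f x = y \<and> norm x \<le> (2 * C) * norm y" for y
  proof -
    \<comment> \<open>the residual left after \<open>n\<close> corrections\<close>
    define r where "r n = ((\<lambda>v. v - f (g v)) ^^ n) y" for n
    have r: "r 0 = y" "r (Suc n) = r n - f (g (r n))" for n by (simp_all add: r_def)
    have rn: "norm (r n) \<le> norm y * (1 / 2) ^ n" for n
    proof (induction n)
      case (Suc n)
      then show ?case using g(3)[of "r n"] by (simp add: r)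
    qed (simp add: r)
    have gn: "norm (g (r n)) \<le> C * norm y * (1 / 2) ^ n" for n
      using order_trans[OF g(2) mult_left_mono[OF rn]] \<open>C > 0\<close> by (simp add: mult.assoc)
    have geo: "(\<lambda>n. C * norm y * (1 / 2) ^ n) sums (C * norm y * 2)"
      using sums_mult[OF geometric_sums[of "1/2::real"], of "C * norm y"] by simp
    have sg: "summable (\<lambda>n. g (r n))"
      by (rule summable_comparison_test'[OF sums_summable[OF geo], of 0]) (use gn in auto)
    define x where "x = (\<Sum>n. g (r n))"
    have "x \<in> U"
    proof (rule closed_sequentially[OF \<open>closed U\<close>])
      show "(\<lambda>n. \<Sum>i<n. g (r i)) \<longlonglongrightarrow> x" unfolding x_def using sg by (rule summable_LIMSEQ)
      show "(\<Sum>i<n. g (r i)) \<in> U" for n using sub g(1) by (auto intro: subspace_sum)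
    qed
    moreover have "norm x \<le> C * norm y * 2"
    proof -
      have "norm x \<le> (\<Sum>n. C * norm y * (1 / 2) ^ n)"
        unfolding x_def using gn by (intro norm_suminf_le sums_summable[OF geo])
      then show ?thesis using sums_unique[OF geo] by simp
    qed
    moreover have "f x = y"
    proof -
      have "(\<lambda>n. norm y * (1 / 2) ^ n) \<longlonglongrightarrow> 0"
        by (intro tendsto_mult_right_zero LIMSEQ_realpow_zero) auto
      then have "r \<longlonglongrightarrow> 0"
        by (rule Lim_null_comparison[rotated]) (use rn in auto)
      then have "(\<lambda>n. r n - r (Suc n)) sums (r 0 - 0)" by (rule telescope_sums')
      then have "(\<lambda>n. f (g (r n))) sums y" by (simp add: r)
      moreover have "(\<lambda>n. f (g (r n))) sums f x"
        unfolding x_def by (intro f.sums summable_sums sg)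
      ultimately show ?thesis using sums_unique2 by blast
    qed
    ultimately show ?thesis by (auto simp: mult_ac)
  qed
  moreover have "2 * C > 0" using C by simp
  ultimately show ?thesis using that by blast
qed

section \<open>Operators bounded below\<close>

text \<open>Continuity of the inverse at \<open>0\<close>, made quantitative by homogeneity.\<close>

lemma homeomorphism_imp_bounded_below:
  fixes f :: "'a::real_normed_vector \<Rightarrow> 'b::real_normed_vector"
  assumes f: "linear f" and Z: "subspace Z" and hom: "homeomorphism Z (f ` Z) f g"
  obtains c where "c > 0" "\<And>z. z \<in> Z \<Longrightarrow> norm z \<le> c * norm (f z)"
proof -
  have g: "\<And>z. z \<in> Z \<Longrightarrow> g (f z) = z" "continuous_on (f ` Z) g"
    using hom by (auto simp: homeomorphism_def)
  have 0: "0 \<in> Z" "f 0 = 0" using Z f by (auto simp: subspace_0 linear_0)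
  then have "0 \<in> f ` Z" "g 0 = 0" using g(1)[of 0] by (force, simp)
  then obtain d where d: "d > 0" "\<And>y. y \<in> f ` Z \<Longrightarrow> norm y < d \<Longrightarrow> norm (g y) < 1"
    using g(2) unfolding continuous_on_iff by (metis dist_0_norm dist_commute zero_less_one)
  have "norm z \<le> (2 / d) * norm (f z)" if z: "z \<in> Z" for z
  proof (cases "z = 0")
    case False
    show ?thesis
    proof (rule ccontr)
      assume "\<not> ?thesis"
      then have *: "norm (f z) < d * norm z" using d False
        by (simp add: field_simps) (smt (verit) norm_ge_zero)
      let ?w = "z /\<^sub>R norm z"
      have w: "?w \<in> Z" using z Z by (simp add: subspace_scale)
      have "norm (f ?w) < d" using * False by (simp add: linear_scale[OF f] field_simps)
      then have "norm ?w < 1" using d(2)[of "f ?w"] w g(1) by auto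
      then show False using False by simp
    qed
  qed (simp add: 0)
  moreover have "2 / d > 0" using d by simp
  ultimately show ?thesis using that by blast
qed

lemma bounded_below_imp_homeomorphism:
  fixes f :: "'a::real_normed_vector \<Rightarrow> 'b::real_normed_vector"
  assumes f: "bounded_linear f" and Z: "subspace Z"
    and below: "\<And>z. z \<in> Z \<Longrightarrow> norm z \<le> c * norm (f z)"
  shows "homeomorphism Z (f ` Z) f (the_inv_into Z f)"
proof -
  interpret f: bounded_linear f by fact
  have d: "norm (x - y) \<le> c * norm (f x - f y)" if "x \<in> Z" "y \<in> Z" for x y
    using below[of "x - y"] that Z by (simp add: subspace_diff f.diff)
  have inj: "inj_on f Z"
  proof (rule inj_onI)
    fix x y assume "x \<in> Z" "y \<in> Z" "f x = f y"
    then show "x = y" using d[of x y] by simp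
  qed
  have "(\<bar>c\<bar>)-lipschitz_on (f ` Z) (the_inv_into Z f)"
  proof (rule lipschitz_onI)
    fix u v assume "u \<in> f ` Z" "v \<in> f ` Z"
    then obtain x y where xy: "x \<in> Z" "y \<in> Z" "u = f x" "v = f y" by blast
    have "c * norm (f x - f y) \<le> \<bar>c\<bar> * norm (f x - f y)" by (intro mult_right_mono) auto
    then show "dist (the_inv_into Z f u) (the_inv_into Z f v) \<le> \<bar>c\<bar> * dist u v"
      using d[of x y] xy by (simp add: the_inv_into_f_f[OF inj] dist_norm)
  qed simp
  then have "continuous_on (f ` Z) (the_inv_into Z f)" by (rule lipschitz_on_continuous_on)
  then show ?thesis
    by (intro homeomorphismI f.continuous_on continuous_on_id)
      (auto simp: the_inv_into_f_f[OF inj])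
qed

section \<open>Strict singularity of operators from \<open>\<ell>\<^sup>1\<close> to \<open>\<ell>\<^sup>2\<close>\<close>

lemma linear_ell1_nth: "linear (\<lambda>x. ell1_nth x k)"
  by (rule linearI) auto

lemma infinite_dim_vanishing_unit_vector:
  assumes Z: "subspace Z" and inf: "\<not> finite_dim Z"
  obtains w where "w \<in> Z" "norm w = 1" "\<And>k. k < N \<Longrightarrow> ell1_nth w k = 0"
proof -
  have sub: "subspace {x \<in> Z. \<forall>k<N. ell1_nth x k = 0}" for N
    using Z by (auto simp: subspace_def)
  have "\<not> finite_dim {x \<in> Z. \<forall>k<N. ell1_nth x k = 0}"
  proof (induction N)
    case (Suc N)
    have "{x \<in> Z. \<forall>k<Suc N. ell1_nth x k = 0}
        = {x \<in> {x \<in> Z. \<forall>k<N. ell1_nth x k = 0}. ell1_nth x N = 0}"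
      by (auto simp: less_Suc_eq)
    then show ?case using Suc finite_dim_if_finite_dim_kernel[OF sub linear_ell1_nth, of N N] by auto
  qed (simp add: inf)
  moreover have "finite_dim {0::ell1}"
    unfolding finite_dim_iff_finite_span by (rule exI[of _ "{}"]) simp
  ultimately have "{x \<in> Z. \<forall>k<N. ell1_nth x k = 0} \<noteq> {0}" by auto
  then obtain w where w: "w \<in> Z" "\<forall>k<N. ell1_nth w k = 0" "w \<noteq> 0"
    using subspace_0[OF sub] by blast
  then show ?thesis
    using Z by (intro that[of "w /\<^sub>R norm w"]) (auto simp: subspace_scale)
qed

text \<open>The norm of \<open>\<ell>\<^sup>1\<close> is additive on disjoint supports; a tail of \<open>z\<close> of norm at most \<open>e\<close> that overlaps
  the support of \<open>w\<close> costs at most \<open>e\<close> in each of the two summands.\<close>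

lemma norm_add_disjoint_tail:
  assumes tail: "(\<Sum>k. \<bar>ell1_nth z (k + N)\<bar>) \<le> e" and w: "\<And>k. k < N \<Longrightarrow> ell1_nth w k = 0"
  shows "norm (z + w) \<ge> norm z + norm w - 2 * e"
proof -
  have split: "norm x = (\<Sum>k. \<bar>ell1_nth x (k + N)\<bar>) + (\<Sum>k<N. \<bar>ell1_nth x k\<bar>)" for x
    using suminf_split_initial_segment[OF summable_ell1, of x N] by (simp add: norm_ell1.rep_eq)
  have s: "summable (\<lambda>k. \<bar>ell1_nth x (k + N)\<bar>)" for x
    by (rule summable_ignore_initial_segment[OF summable_ell1])
  have "(\<Sum>k. \<bar>ell1_nth w (k + N)\<bar>)
      \<le> (\<Sum>k. \<bar>ell1_nth (z + w) (k + N)\<bar> + \<bar>ell1_nth z (k + N)\<bar>)"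
    by (intro suminf_le s summable_add) auto
  also have "\<dots> = (\<Sum>k. \<bar>ell1_nth (z + w) (k + N)\<bar>) + (\<Sum>k. \<bar>ell1_nth z (k + N)\<bar>)"
    by (rule suminf_add[symmetric]) (rule s)+
  finally show ?thesis
    using split[of z] split[of w] split[of "z + w"] tail w by simp
qed

text \<open>The gliding hump. Each step adds to \<open>z\<close> a unit vector \<open>w\<close> or its negative. Because \<open>w\<close>
  vanishes where almost all of \<open>z\<close> lives, the norm of \<open>\<ell>\<^sup>1\<close> grows by at least \<open>1/2\<close> for
  either sign; the sign is left free to make the inner product of the images nonpositive, so that the
  squared norm in \<open>\<ell>\<^sup>2\<close> grows by at most \<open>\<parallel>B\<parallel>\<^sup>2\<close>.\<close>

lemma signed_sums:
  fixes B :: "ell1 \<Rightarrow>\<^sub>L ell2"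
  assumes Z: "subspace Z" and inf: "\<not> finite_dim Z"
  shows "\<exists>z\<in>Z. norm z \<ge> real n / 2 \<and> (norm (B z))\<^sup>2 \<le> real n * (norm B)\<^sup>2"
proof (induction n)
  case 0
  show ?case using Z by (intro bexI[of _ 0]) (auto simp: subspace_0)
next
  case (Suc n)
  then obtain z where z: "z \<in> Z" "norm z \<ge> real n / 2" "(norm (B z))\<^sup>2 \<le> real n * (norm B)\<^sup>2"
    by blast
  have "(\<lambda>N. \<Sum>k. \<bar>ell1_nth z (k + N)\<bar>) \<longlonglongrightarrow> 0"
    by (rule suminf_exist_split2[OF summable_ell1])
  then have "\<forall>\<^sub>F N in sequentially. (\<Sum>k. \<bar>ell1_nth z (k + N)\<bar>) < 1 / 4"
    by (rule order_tendstoD) simp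
  then obtain N where N: "(\<Sum>k. \<bar>ell1_nth z (k + N)\<bar>) \<le> 1 / 4"
    by (auto simp: eventually_sequentially intro: less_imp_le)
  obtain w where w: "w \<in> Z" "norm w = 1" "\<And>k. k < N \<Longrightarrow> ell1_nth w k = 0"
    using infinite_dim_vanishing_unit_vector[OF Z inf, of N] by blast
  define v where "v = (if inner (B z) (B w) \<le> 0 then w else - w)"
  have v: "v \<in> Z" "norm v = 1" "\<And>k. k < N \<Longrightarrow> ell1_nth v k = 0" "inner (B z) (B v) \<le> 0"
    using w Z by (auto simp: v_def subspace_neg blinfun.minus_right)
  have "norm (z + v) \<ge> real (Suc n) / 2"
    using norm_add_disjoint_tail[OF N v(3)] v(2) z(2) by simp
  moreover have "(norm (B (z + v)))\<^sup>2 \<le> real (Suc n) * (norm B)\<^sup>2"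
  proof -
    have "(norm (B (z + v)))\<^sup>2 = (norm (B z))\<^sup>2 + 2 * inner (B z) (B v) + (norm (B v))\<^sup>2"
      by (simp add: blinfun.add_right power2_norm_eq_inner inner_add inner_commute)
    moreover have "(norm (B v))\<^sup>2 \<le> (norm B)\<^sup>2"
      using norm_blinfun[of B v] v(2) by (intro power_mono) auto
    moreover have "real (Suc n) * (norm B)\<^sup>2 = real n * (norm B)\<^sup>2 + (norm B)\<^sup>2"
      by (simp add: algebra_simps)
    ultimately show ?thesis using z(3) v(4) by linarith
  qed
  ultimately show ?case using Z z(1) v(1) by (intro bexI[of _ "z + v"]) (auto simp: subspace_add)
qed

text \<open>A lower bound with constant \<open>c\<close> would give \<open>n / 2 \<le> c \<parallel>B\<parallel> \<surd>n\<close> for every \<open>n\<close>.\<close>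

lemma not_bounded_below_ell1_ell2:
  fixes B :: "ell1 \<Rightarrow>\<^sub>L ell2"
  assumes Z: "subspace Z" and inf: "\<not> finite_dim Z"
  shows "\<exists>z\<in>Z. norm z > c * norm (B z)"
proof (rule ccontr)
  assume "\<not> ?thesis"
  then have below: "norm z \<le> c * norm (B z)" if "z \<in> Z" for z using that by force
  obtain n where n: "4 * c\<^sup>2 * (norm B)\<^sup>2 < real n" using reals_Archimedean2 by blast
  obtain z where z: "z \<in> Z" "norm z \<ge> real n / 2" "(norm (B z))\<^sup>2 \<le> real n * (norm B)\<^sup>2"
    using signed_sums[OF Z inf] by blast
  have n0: "real n > 0" using n by (smt (verit) mult_nonneg_nonneg zero_le_power2)
  have "(real n / 2)\<^sup>2 \<le> (c * norm (B z))\<^sup>2"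
    using below[OF z(1)] z(2) by (intro power_mono) auto
  also have "\<dots> \<le> c\<^sup>2 * (real n * (norm B)\<^sup>2)"
    unfolding power_mult_distrib using z(3) by (intro mult_left_mono) auto
  finally have "real n * real n \<le> real n * (4 * c\<^sup>2 * (norm B)\<^sup>2)"
    by (simp add: power2_eq_square algebra_simps)
  then show False using n n0 by simp
qed

lemma strictly_singular_ell1_ell2:
  fixes B :: "ell1 \<Rightarrow>\<^sub>L ell2"
  shows "strictly_singular B"
  unfolding strictly_singular_def
proof (intro allI impI notI)
  fix Z
  assume Z: "closed_subspace Z \<and> \<not> finite_dim Z"
    and "\<exists>g. homeomorphism Z (blinfun_apply B ` Z) (blinfun_apply B) g"
  then obtain g where g: "homeomorphism Z (blinfun_apply B ` Z) (blinfun_apply B) g" by blast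
  have sub: "subspace Z" using Z by (simp add: closed_subspace_def)
  obtain c where "\<And>z. z \<in> Z \<Longrightarrow> norm z \<le> c * norm (B z)"
    using homeomorphism_imp_bounded_below[OF _ sub g]
      bounded_linear.linear[OF blinfun.bounded_linear_right] by metis
  then show False using not_bounded_below_ell1_ell2[OF sub, of c B] Z by force
qed

section \<open>Unit vectors and bounded functionals of \<open>\<ell>\<^sup>2\<close>\<close>

lift_definition ell2_unit :: "nat \<Rightarrow> ell2" is "\<lambda>i k. if k = i then 1 else 0"
proof -
  fix i
  show "summable (\<lambda>k. (if k = i then 1 else 0 :: real)\<^sup>2)"
    by (rule summable_finite[of "{i}"]) auto
qed

lemma inner_ell2_unit: "inner x (ell2_unit i) = ell2_nth x i"
proof transfer
  fix x :: "nat \<Rightarrow> real" and i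
  have "(\<Sum>k. x k * (if k = i then 1 else 0)) = (\<Sum>k\<in>{i}. x k * (if k = i then 1 else 0))"
    by (rule suminf_finite) auto
  then show "(\<Sum>k. x k * (if k = i then 1 else 0)) = x i" by simp
qed

lemma infinite_dim_ell2: "\<not> finite_dim (UNIV :: ell2 set)"
proof
  assume "finite_dim (UNIV :: ell2 set)"
  then obtain E :: "ell2 set" where E: "finite E" "span E = UNIV" by (auto simp: finite_dim_def)
  have nth: "ell2_nth (ell2_unit i) k = (if k = i then 1 else 0)" for i k
    by (simp add: ell2_unit.rep_eq)
  have "inj ell2_unit" by (rule injI) (metis nth zero_neq_one)
  moreover have "independent (range ell2_unit)"
  proof (rule pairwise_orthogonal_independent)
    show "pairwise orthogonal (range ell2_unit)"
      by (auto simp: pairwise_def orthogonal_def inner_ell2_unit nth)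
    have "ell2_unit i \<noteq> 0" for i by (metis nth ell2_nth_simps(1) zero_neq_one)
    then show "0 \<notin> range ell2_unit" by (metis imageE)
  qed
  ultimately show False
    using independent_span_bound[OF E(1), of "range ell2_unit"] E(2) by (auto dest: finite_imageD)
qed

lemma ell2_nth_sum: "ell2_nth (\<Sum>i\<in>I. f i) k = (\<Sum>i\<in>I. ell2_nth (f i) k)"
  by (induction I rule: infinite_finite_induct) auto

lemma ell2_partial_sum_nth:
  "ell2_nth (\<Sum>i<n. a i *\<^sub>R ell2_unit i) k = (if k < n then a k else 0)"
proof -
  have "(\<Sum>i<n. a i * ell2_nth (ell2_unit i) k) = (\<Sum>i<n. if i = k then a k else 0)"
    by (intro sum.cong) (auto simp: ell2_unit.rep_eq)
  then show ?thesis by (simp add: ell2_nth_sum)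
qed

lemma ell2_partial_sum_norm: "(norm (\<Sum>i<n. a i *\<^sub>R ell2_unit i))\<^sup>2 = (\<Sum>i<n. (a i)\<^sup>2)"
  unfolding power2_norm_eq_inner inner_sum_right
  by (simp add: inner_ell2_unit ell2_partial_sum_nth power2_eq_square)

lemma ell2_expansion: "(\<lambda>k. ell2_nth y k *\<^sub>R ell2_unit k) sums y"
proof -
  have n2: "(norm x)\<^sup>2 = (\<Sum>k. (ell2_nth x k)\<^sup>2)" for x
    by (simp add: norm_ell2.rep_eq suminf_nonneg summable_ell2)
  have eq: "(norm (y - (\<Sum>i<n. ell2_nth y i *\<^sub>R ell2_unit i)))\<^sup>2
      = (\<Sum>k. (ell2_nth y (k + n))\<^sup>2)" (is "(norm ?d)\<^sup>2 = _") for n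
  proof -
    have d: "ell2_nth ?d k = (if k < n then 0 else ell2_nth y k)" for k
      by (simp add: ell2_partial_sum_nth)
    have "(norm ?d)\<^sup>2 = (\<Sum>k. (ell2_nth ?d (k + n))\<^sup>2) + (\<Sum>k<n. (ell2_nth ?d k)\<^sup>2)"
      unfolding n2 by (rule suminf_split_initial_segment) (rule summable_ell2)
    also have "\<dots> = (\<Sum>k. (ell2_nth y (k + n))\<^sup>2)" unfolding d by simp
    finally show ?thesis .
  qed
  have "(\<lambda>n. (norm (y - (\<Sum>i<n. ell2_nth y i *\<^sub>R ell2_unit i)))\<^sup>2) \<longlonglongrightarrow> 0"
    unfolding eq by (rule suminf_exist_split2[OF summable_ell2])
  then have "(\<lambda>n. norm (y - (\<Sum>i<n. ell2_nth y i *\<^sub>R ell2_unit i))) \<longlonglongrightarrow> 0"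
    using tendsto_real_sqrt[of _ 0 sequentially] by fastforce
  then have "(\<lambda>n. (\<Sum>i<n. ell2_nth y i *\<^sub>R ell2_unit i) - y) \<longlonglongrightarrow> 0"
    by (subst (asm) norm_minus_commute) (simp add: tendsto_norm_zero_iff)
  then show ?thesis unfolding sums_def by (simp add: LIM_zero_iff)
qed

text \<open>The Riesz representation theorem in coordinates: the representing vector can only have the
  entries \<open>\<phi> e\<^sub>k\<close>. They are square-summable because applying \<open>\<phi>\<close> to the partial sum
  \<open>s = \<Sum>\<^sub>k \<phi> e\<^sub>k \<cdot> e\<^sub>k\<close> gives \<open>\<parallel>s\<parallel>\<^sup>2\<close>, which is at most \<open>K\<cdot>\<parallel>s\<parallel>\<close>.\<close>

lemma ell2_riesz:
  assumes "bounded_linear (\<phi> :: ell2 \<Rightarrow> real)"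
  obtains \<eta> where "\<And>y. \<phi> y = inner \<eta> y"
proof -
  interpret \<phi>: bounded_linear \<phi> by fact
  obtain K where K: "\<And>y. norm (\<phi> y) \<le> norm y * K" using \<phi>.bounded by blast
  let ?a = "\<lambda>k. \<phi> (ell2_unit k)"
  have bd: "(\<Sum>k<n. (?a k)\<^sup>2) \<le> K\<^sup>2" for n
  proof -
    let ?s = "\<Sum>k<n. ?a k *\<^sub>R ell2_unit k"
    have "(norm ?s)\<^sup>2 = \<phi> ?s"
      unfolding ell2_partial_sum_norm by (simp add: \<phi>.sum \<phi>.scaleR power2_eq_square)
    also have "\<dots> \<le> norm ?s * K" using K[of ?s] by simp
    finally have "norm ?s \<le> \<bar>K\<bar>"
      by (cases "norm ?s = 0") (auto simp: power2_eq_square)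
    then have "(norm ?s)\<^sup>2 \<le> K\<^sup>2" using power_mono[of "norm ?s" "\<bar>K\<bar>" 2] by simp
    then show ?thesis by (simp add: ell2_partial_sum_norm)
  qed
  have "summable (\<lambda>k. (?a k)\<^sup>2)"
    by (rule bounded_imp_summable[where B = "K\<^sup>2"])
      (use bd in \<open>auto simp: lessThan_Suc_atMost[symmetric] simp del: sum.lessThan_Suc\<close>)
  then have \<eta>: "ell2_nth (Abs_ell2 ?a) = ?a" by (simp add: Abs_ell2_inverse)
  have "\<phi> y = inner (Abs_ell2 ?a) y" for y
  proof -
    have "(\<lambda>k. ell2_nth y k * ?a k) sums \<phi> y"
      using \<phi>.sums[OF ell2_expansion] by (simp add: \<phi>.scaleR)
    moreover have "(\<lambda>k. ell2_nth y k * ?a k) sums inner (Abs_ell2 ?a) y"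
      using bounded_linear.sums[OF bounded_linear_inner_right ell2_expansion[of y], of "Abs_ell2 ?a"]
      by (simp add: inner_ell2_unit \<eta>)
    ultimately show ?thesis using sums_unique2 by blast
  qed
  then show ?thesis using that by blast
qed

section \<open>The null space\<close>

lemma closed_subspace_null_space: "closed_subspace (null_space A)"
proof -
  have "null_space A = blinfun_apply A -` {0}" by (auto simp: null_space_def)
  moreover have "closed (blinfun_apply A -` {0})"
    by (intro closed_vimage) (auto intro: linear_continuous_on blinfun.bounded_linear_right continuous_intros)
  moreover have "subspace (null_space A)"
    by (auto simp: null_space_def subspace_def blinfun.add_right blinfun.scaleR_right)
  ultimately show ?thesis by (simp add: closed_subspace_def)
qed

text \<open>On a complement, \<open>B\<close> is injective, so the preimage of bounded norm that the open
  mapping theorem supplies for \<open>B z\<close> is \<open>z\<close> itself.\<close>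

lemma not_complemented_null_space:
  fixes B :: "ell1 \<Rightarrow>\<^sub>L ell2"
  assumes "surj (blinfun_apply B)"
  shows "\<not> complemented (null_space B)"
proof
  assume "complemented (null_space B)"
  then obtain U where U: "closed_subspace U" "null_space B + U = UNIV" "null_space B \<inter> U = {0}"
    by (auto simp: complemented_def)
  have sub: "subspace U" using U by (simp add: closed_subspace_def)
  have onto: "blinfun_apply B ` U = UNIV"
  proof -
    have "y \<in> blinfun_apply B ` U" for y
    proof -
      obtain x where x: "y = B x" using assms by blast
      obtain n u where "n \<in> null_space B" "u \<in> U" "x = n + u"
        using U(2) by (metis UNIV_I set_plus_elim)
      then show ?thesis using x by (auto simp: null_space_def blinfun.add_right)
    qed
    then show ?thesis by blast
  qed
  obtain C where C: "\<And>y. \<exists>x\<in>U. B x = y \<and> norm x \<le> C * norm y"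
    using open_mapping_bounded_preimages[OF U(1) blinfun.bounded_linear_right onto] by metis
  have "norm z \<le> C * norm (B z)" if z: "z \<in> U" for z
  proof -
    obtain x where x: "x \<in> U" "B x = B z" "norm x \<le> C * norm (B z)" using C by blast
    then have "x - z \<in> null_space B \<inter> U"
      using z sub by (auto simp: null_space_def blinfun.diff_right subspace_diff)
    then show ?thesis using U(3) x by simp
  qed
  moreover have "\<not> finite_dim U"
    using finite_dim_linear_image[OF bounded_linear.linear[OF blinfun.bounded_linear_right], of U B]
      infinite_dim_ell2 unfolding onto by blast
  ultimately show False using not_bounded_below_ell1_ell2[OF sub, of C B] by force
qed

text \<open>Coordinates separate points, so a complement can be built one spanning vector at a time, without
  extending functionals: if the component \<open>u\<close> in \<open>U\<close> of the new vector has a nonzero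
  \<open>k\<close>-th entry, the vectors of \<open>U\<close> with vanishing \<open>k\<close>-th entry form the next complement.\<close>

lemma finite_span_complement_ell1:
  fixes E :: "ell1 set"
  assumes "finite E"
  shows "\<exists>U. closed_subspace U \<and> span E + U = UNIV \<and> span E \<inter> U = {0}"
  using assms
proof induction
  case empty
  have "span {} + UNIV = (UNIV :: ell1 set)" by (simp add: set_plus_def)
  moreover have "closed_subspace (UNIV :: ell1 set)" by (simp add: closed_subspace_def)
  ultimately show ?case by (intro exI[of _ UNIV] conjI) simp_all
next
  case (insert a E)
  obtain U where U: "closed_subspace U" "span E + U = UNIV" "span E \<inter> U = {0}"
    using insert.IH by (elim exE conjE)
  have sub: "subspace U" using U by (simp add: closed_subspace_def)
  show ?case
  proof (cases "a \<in> span E")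
    case True
    then show ?thesis using U span_redundant by metis
  next
    case False
    obtain e u where eu: "e \<in> span E" "u \<in> U" "a = e + u"
      using U(2) by (metis UNIV_I set_plus_elim)
    then have "u \<noteq> 0" using False by auto
    then obtain k where k: "ell1_nth u k \<noteq> 0" using ell1_eqI[of u 0] by auto
    let ?V = "{x \<in> U. ell1_nth x k = 0}"
    have "bounded_linear (\<lambda>x. ell1_nth x k)"
      by (rule bounded_linear_intro[of _ 1]) (use abs_ell1_nth_le_norm in auto)
    then have "closed ((\<lambda>x. ell1_nth x k) -` {0})"
      by (intro closed_vimage) (auto intro: linear_continuous_on)
    then have "closed (U \<inter> (\<lambda>x. ell1_nth x k) -` {0})"
      using U by (auto simp: closed_subspace_def)
    moreover have "U \<inter> (\<lambda>x. ell1_nth x k) -` {0} = ?V" by auto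
    ultimately have "closed_subspace ?V"
      using sub by (auto simp: closed_subspace_def subspace_def)
    moreover have "x \<in> span (insert a E) + ?V" for x
    proof -
      obtain e' u' where x: "e' \<in> span E" "u' \<in> U" "x = e' + u'"
        using U(2) by (metis UNIV_I set_plus_elim)
      define t where "t = ell1_nth u' k / ell1_nth u k"
      have "e' - t *\<^sub>R e + t *\<^sub>R a \<in> span (insert a E)"
        using x eu(1) span_mono[of E "insert a E"]
        by (intro span_add span_diff span_scale) (auto intro: span_base)
      moreover have "u' - t *\<^sub>R u \<in> ?V"
        using x eu sub k by (auto simp: t_def subspace_diff subspace_scale)
      moreover have "x = (e' - t *\<^sub>R e + t *\<^sub>R a) + (u' - t *\<^sub>R u)"
        by (simp add: x eu scaleR_add_right)
      ultimately show ?thesis using set_plus_intro by metis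
    qed
    moreover have "x = 0" if x: "x \<in> span (insert a E)" "x \<in> ?V" for x
    proof -
      obtain t where t: "x - t *\<^sub>R a \<in> span E" using x(1) unfolding span_insert by blast
      have "x - t *\<^sub>R u = (x - t *\<^sub>R a) + t *\<^sub>R e" by (simp add: eu scaleR_add_right)
      also have "\<dots> \<in> span E" using t eu by (intro span_add span_scale)
      finally have "x - t *\<^sub>R u \<in> span E \<inter> U"
        using x eu sub by (auto simp: subspace_diff subspace_scale)
      then have xt: "x = t *\<^sub>R u" using U(3) by simp
      then have "t = 0" using x(2) k by auto
      then show ?thesis using xt by simp
    qed
    ultimately show ?thesis
      using sub by (intro exI[of _ ?V]) (auto simp: span_zero subspace_0)
  qed
qed

lemma finite_dim_imp_complemented_ell1:
  fixes N :: "ell1 set"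
  assumes "closed_subspace N" "finite_dim N"
  shows "complemented N"
  using assms finite_span_complement_ell1 unfolding complemented_def finite_dim_def by metis

text \<open>The operator is constant on each coset of its null space; its values on finitely many spanning
  cosets span the range.\<close>

lemma finite_codim_null_space_imp_finite_dim_range:
  fixes A :: "'a::real_normed_vector \<Rightarrow>\<^sub>L 'b::real_normed_vector"
  assumes "finite_codim (null_space A)"
  shows "finite_dim (op_range A)"
proof -
  let ?N = "null_space A"
  obtain F where F: "finite F" "F \<subseteq> quotient_space ?N"
    "\<forall>C\<in>quotient_space ?N. \<exists>c::'a set \<Rightarrow> real. C = ?N + (\<Sum>D\<in>F. (\<lambda>v. c D *\<^sub>R v) ` D)"
    using assms unfolding finite_codim_def by (elim exE conjE)
  have coset: "\<exists>y\<in>op_range A. \<forall>v\<in>D. A v = y" if D: "D \<in> F" for D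
  proof -
    obtain x where "D = {x} + ?N" using subsetD[OF F(2) D] unfolding quotient_space_def by (elim rangeE)
    then show ?thesis
      by (intro bexI[of _ "A x"]) (auto simp: set_plus_def null_space_def blinfun.add_right)
  qed
  then obtain b where b: "\<And>D v. D \<in> F \<Longrightarrow> v \<in> D \<Longrightarrow> A v = b D"
    "\<And>D. D \<in> F \<Longrightarrow> b D \<in> op_range A" by metis
  have "A x \<in> span (b ` F)" for x
  proof -
    have "0 \<in> ?N" by (simp add: null_space_def)
    then have x: "x \<in> {x} + ?N" by (metis add.right_neutral insertI1 set_plus_intro)
    have mem: "{x} + ?N \<in> quotient_space ?N" by (simp add: quotient_space_def)
    obtain c :: "'a set \<Rightarrow> real"
      where c: "{x} + ?N = ?N + (\<Sum>D\<in>F. (\<lambda>v. c D *\<^sub>R v) ` D)"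
      using bspec[OF F(3) mem] by (elim exE)
    then obtain n s where ns: "n \<in> ?N" "s \<in> (\<Sum>D\<in>F. (\<lambda>v. c D *\<^sub>R v) ` D)" "x = n + s"
      using x unfolding c by (elim set_plus_elim)
    then obtain d where d: "s = sum d F" "\<forall>D\<in>F. d D \<in> (\<lambda>v. c D *\<^sub>R v) ` D"
      using F(1) by (auto simp: set_sum_alt)
    have "A (d D) = c D *\<^sub>R b D" if "D \<in> F" for D
      using d(2) b that by (auto simp: blinfun.scaleR_right)
    then have "A x = (\<Sum>D\<in>F. c D *\<^sub>R b D)"
      using ns d by (simp add: null_space_def blinfun.add_right blinfun.sum_right)
    then show ?thesis by (auto intro: span_sum span_scale span_base)
  qed
  moreover have "subspace (op_range A)"
    using linear_subspace_image[OF bounded_linear.linear[OF blinfun.bounded_linear_right] subspace_UNIV] .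
  ultimately have "span (b ` F) = op_range A"
    using b(2) by (intro subset_antisym span_minimal) auto
  then show ?thesis unfolding finite_dim_iff_finite_span using F(1) by blast
qed

section \<open>The adjoint\<close>

lemma adjoint_op_nth: "apply_bcontfun (adjoint_op B \<eta>) k = inner \<eta> (B (ell1_unit k))"
  unfolding adjoint_op by (rule suminf_mult_ell1_unit[symmetric])

lemma summable_bcontfun_mult_ell1:
  "summable (\<lambda>k. \<bar>apply_bcontfun \<xi> k * ell1_nth x k\<bar>)"
  "\<bar>\<Sum>k. apply_bcontfun \<xi> k * ell1_nth x k\<bar> \<le> norm \<xi> * norm x"
proof -
  have le: "\<bar>apply_bcontfun \<xi> k * ell1_nth x k\<bar> \<le> norm \<xi> * \<bar>ell1_nth x k\<bar>" for k
    using norm_bounded[of \<xi> k] by (simp add: abs_mult mult_right_mono)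
  have s: "summable (\<lambda>k. norm \<xi> * \<bar>ell1_nth x k\<bar>)" by (intro summable_mult summable_ell1)
  show *: "summable (\<lambda>k. \<bar>apply_bcontfun \<xi> k * ell1_nth x k\<bar>)"
    by (rule summable_comparison_test'[OF s, of 0]) (use le in auto)
  have "\<bar>\<Sum>k. apply_bcontfun \<xi> k * ell1_nth x k\<bar> \<le> (\<Sum>k. \<bar>apply_bcontfun \<xi> k * ell1_nth x k\<bar>)"
    by (rule summable_rabs[OF *])
  also have "\<dots> \<le> (\<Sum>k. norm \<xi> * \<bar>ell1_nth x k\<bar>)" by (intro suminf_le le * s)
  also have "\<dots> = norm \<xi> * norm x" by (simp add: suminf_mult summable_ell1 norm_ell1.rep_eq)
  finally show "\<bar>\<Sum>k. apply_bcontfun \<xi> k * ell1_nth x k\<bar> \<le> norm \<xi> * norm x" .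
qed

text \<open>With \<open>B x = \<eta>\<close>, the pairing of \<open>B\<^sup>*\<eta>\<close> with \<open>x\<close> is \<open>\<parallel>\<eta>\<parallel>\<^sup>2\<close>, and \<open>x\<close> may be taken of
  norm at most \<open>C\<cdot>\<parallel>\<eta>\<parallel>\<close>.\<close>

lemma adjoint_op_bounded_below:
  fixes B :: "ell1 \<Rightarrow>\<^sub>L ell2"
  assumes C: "\<And>y. \<exists>x. B x = y \<and> norm x \<le> C * norm y"
  shows "norm \<eta> \<le> C * norm (adjoint_op B \<eta>)"
proof (cases "\<eta> = 0")
  case False
  obtain x where x: "B x = \<eta>" "norm x \<le> C * norm \<eta>" using C by blast
  have "norm \<eta> * norm \<eta> = inner \<eta> (B x)" by (simp add: x norm_eq_sqrt_inner)
  also have "\<dots> \<le> norm (adjoint_op B \<eta>) * norm x"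
    unfolding adjoint_op using summable_bcontfun_mult_ell1(2) abs_le_D1 by blast
  also have "\<dots> \<le> norm (adjoint_op B \<eta>) * (C * norm \<eta>)" by (intro mult_left_mono x) auto
  finally show ?thesis using False by (simp add: mult_ac)
qed (simp add: blinfun.zero_right)

text \<open>A functional that annihilates the null space takes the same value on all preimages of \<open>y\<close>, so it
  induces a functional of \<open>y\<close>, bounded because preimages of controlled norm exist. Its representing
  vector is the sought preimage under the adjoint.\<close>

lemma annihilator_subset_range_adjoint_op:
  fixes B :: "ell1 \<Rightarrow>\<^sub>L ell2"
  assumes C: "\<And>y. \<exists>x. B x = y \<and> norm x \<le> C * norm y"
  shows "annihilator (null_space B) \<subseteq> op_range (adjoint_op B)"
proof
  fix \<xi> assume \<xi>: "\<xi> \<in> annihilator (null_space B)"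
  let ?L = "\<lambda>x. \<Sum>k. apply_bcontfun \<xi> k * ell1_nth x k"
  note s = summable_rabs_cancel[OF summable_bcontfun_mult_ell1(1)[of \<xi>]]
  have L: "bounded_linear ?L"
  proof (rule bounded_linear_intro)
    show "?L (x + y) = ?L x + ?L y" for x y
      using suminf_add[OF s s, of x y] by (simp add: distrib_left)
    show "?L (r *\<^sub>R x) = r *\<^sub>R ?L x" for r x
      using suminf_mult[OF s, of r x] by (simp add: mult_ac)
    show "norm (?L x) \<le> norm x * norm \<xi>" for x
      using summable_bcontfun_mult_ell1(2)[of \<xi> x] by (simp add: mult.commute)
  qed
  interpret L: bounded_linear ?L by fact
  have eq: "?L x = ?L x'" if "B x = B x'" for x x'
  proof -
    have "x - x' \<in> null_space B" using that by (simp add: null_space_def blinfun.diff_right)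
    then have "?L (x - x') = 0" using \<xi> unfolding annihilator_def by blast
    then show ?thesis unfolding L.diff by simp
  qed
  \<comment> \<open>a choice of preimages; it need not be linear, but \<open>?L \<circ> g\<close> is\<close>
  obtain g where g: "\<And>y. B (g y) = y" "\<And>y. norm (g y) \<le> C * norm y" using C by metis
  have "bounded_linear (\<lambda>y. ?L (g y))"
  proof (rule bounded_linear_intro)
    show "?L (g (y + y')) = ?L (g y) + ?L (g y')" for y y'
      unfolding L.add[symmetric] by (rule eq) (simp add: g blinfun.add_right)
    show "?L (g (r *\<^sub>R y)) = r *\<^sub>R ?L (g y)" for r y
      unfolding L.scaleR[symmetric] by (rule eq) (simp add: g blinfun.scaleR_right)
    show "norm (?L (g y)) \<le> norm y * (norm \<xi> * C)" for y
    proof -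
      have "norm (?L (g y)) \<le> norm \<xi> * norm (g y)"
        using summable_bcontfun_mult_ell1(2)[of \<xi> "g y"] by simp
      also have "\<dots> \<le> norm \<xi> * (C * norm y)" by (intro mult_left_mono g) auto
      finally show ?thesis by (simp add: mult_ac)
    qed
  qed
  then obtain \<eta> where \<eta>: "\<And>y. ?L (g y) = inner \<eta> y" using ell2_riesz by blast
  have "adjoint_op B \<eta> = \<xi>"
  proof (rule bcontfun_eqI)
    fix k
    have "inner \<eta> (B (ell1_unit k)) = ?L (ell1_unit k)"
      unfolding \<eta>[symmetric] by (rule eq) (rule g)
    then show "apply_bcontfun (adjoint_op B \<eta>) k = apply_bcontfun \<xi> k"
      by (simp add: adjoint_op_nth suminf_mult_ell1_unit)
  qed
  then show "\<xi> \<in> op_range (adjoint_op B)" by blast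
qed

lemma range_adjoint_op_subset_annihilator:
  "op_range (adjoint_op B) \<subseteq> annihilator (null_space B)"
  by (auto simp: annihilator_def null_space_def adjoint_op[symmetric])

lemma bounded_below_imp_closed_range:
  fixes A :: "'a::banach \<Rightarrow>\<^sub>L 'b::banach"
  assumes C: "C > 0" and below: "\<And>x. norm x \<le> C * norm (A x)"
  shows "closed (op_range A)"
proof -
  have "complete (op_range A)"
  proof (rule complete_isometric_image)
    show "\<forall>x\<in>UNIV. norm (A x) \<ge> (1 / C) * norm x"
      using below C by (simp add: field_simps)
  qed (use C in \<open>auto simp: blinfun.bounded_linear_right complete_UNIV\<close>)
  then show ?thesis by (rule complete_imp_closed)
qed

lemma mazur_type_unit:
  assumes "mazur_type B \<zeta>"
  shows "B (ell1_unit k) = \<zeta> k"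
proof -
  have "(\<lambda>j. ell1_nth (ell1_unit k) j *\<^sub>R \<zeta> j) sums B (ell1_unit k)"
    using assms by (simp add: mazur_type_def)
  moreover have "(\<lambda>j. ell1_nth (ell1_unit k) j *\<^sub>R \<zeta> j) sums (\<Sum>j\<in>{k}. ell1_nth (ell1_unit k) j *\<^sub>R \<zeta> j)"
    by (rule sums_finite) (auto simp: ell1_unit.rep_eq)
  ultimately show ?thesis using sums_unique2 by (fastforce simp: ell1_unit.rep_eq)
qed

section \<open>Surjective operators from \<open>\<ell>\<^sup>1\<close> onto \<open>\<ell>\<^sup>2\<close>\<close>

theorem theorem3p4:
  fixes B :: "ell1 \<Rightarrow>\<^sub>L ell2"
  assumes "surj (blinfun_apply B)"
  shows "(hybrid_type B \<and> ill_posed_type_I B)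
    \<and> (uncomplemented (null_space B)
        \<and> \<not> finite_dim (null_space B) \<and> \<not> finite_codim (null_space B)
        \<and> \<not> inj (blinfun_apply B))
    \<and> (inj (blinfun_apply (adjoint_op B))
        \<and> \<not> strictly_singular (adjoint_op B)
        \<and> closed (op_range (adjoint_op B))
        \<and> \<not> finite_dim (op_range (adjoint_op B))
        \<and> op_range (adjoint_op B) = annihilator (null_space B)
        \<and> well_posed (adjoint_op B))
    \<and> (\<forall>\<zeta>. mazur_type B \<zeta> \<longrightarrow>
        (\<forall>\<eta>. apply_bcontfun (adjoint_op B \<eta>) = (\<lambda>k. inner \<eta> (\<zeta> k))))"
proof -
  let ?T = "adjoint_op B"
  have UNIV_closed: "closed_subspace (UNIV :: 'c::real_normed_vector set)"
    by (simp add: closed_subspace_def)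
  obtain C where C: "C > 0" "\<And>y. \<exists>x. B x = y \<and> norm x \<le> C * norm y"
    using open_mapping_bounded_preimages[OF UNIV_closed blinfun.bounded_linear_right assms]
    by (metis UNIV_I)
  have not_compl: "\<not> complemented (null_space B)" by (rule not_complemented_null_space[OF assms])
  have range: "range_contains_infinite_dim B"
    unfolding range_contains_infinite_dim_def
    using UNIV_closed infinite_dim_ell2 assms by blast
  have null_dim: "\<not> finite_dim (null_space B)"
    using not_compl finite_dim_imp_complemented_ell1 closed_subspace_null_space by blast
  have codim: "\<not> finite_codim (null_space B)"
    using finite_codim_null_space_imp_finite_dim_range infinite_dim_ell2 assms by metis
  have not_inj: "\<not> inj (blinfun_apply B)"
  proof
    assume "inj (blinfun_apply B)"
    then have "null_space B = span {}"
      by (auto simp: null_space_def blinfun.zero_right dest: injD[of _ _ 0])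
    then show False using null_dim finite_dim_iff_finite_span by blast
  qed
  have below: "norm \<eta> \<le> C * norm (?T \<eta>)" for \<eta>
    by (rule adjoint_op_bounded_below[OF C(2)])
  have T_null: "\<eta> = 0" if "?T \<eta> = 0" for \<eta>
    using below[of \<eta>] that by simp
  have T_inj: "inj (blinfun_apply ?T)"
  proof (rule injI)
    fix x y assume "?T x = ?T y"
    then show "x = y" using T_null[of "x - y"] by (simp add: blinfun.diff_right)
  qed
  have T_not_ss: "\<not> strictly_singular ?T"
    unfolding strictly_singular_def
    using UNIV_closed infinite_dim_ell2
      bounded_below_imp_homeomorphism[OF blinfun.bounded_linear_right subspace_UNIV, of C ?T] below
    by blast
  have T_closed: "closed (op_range ?T)"
    by (rule bounded_below_imp_closed_range[OF C(1) below])
  have T_lin: "linear (blinfun_apply ?T)"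
    by (rule bounded_linear.linear[OF blinfun.bounded_linear_right])
  have T_dim: "\<not> finite_dim (op_range ?T)"
  proof
    assume "finite_dim (op_range ?T)"
    moreover obtain g where "linear g" "g \<circ> ?T = id"
      using linear_injective_left_inverse[OF T_lin T_inj] by blast
    moreover from this have "g ` op_range ?T = UNIV" by (auto simp: fun_eq_iff image_iff)
    ultimately show False using finite_dim_linear_image infinite_dim_ell2 by metis
  qed
  have T_range: "op_range ?T = annihilator (null_space B)"
    using annihilator_subset_range_adjoint_op[OF C(2)] range_adjoint_op_subset_annihilator by blast
  have "null_space ?T = {0}" using T_null by (auto simp: null_space_def blinfun.zero_right)
  then have "complemented (null_space ?T)"
    using closed_subspace_null_space[of ?T] UNIV_closed
    by (auto simp: complemented_def set_plus_def)
  then have T_well: "well_posed ?T" using T_closed by (simp add: well_posed_def)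
  have "apply_bcontfun (?T \<eta>) = (\<lambda>k. inner \<eta> (\<zeta> k))" if "mazur_type B \<zeta>" for \<zeta> \<eta>
    using that by (auto simp: adjoint_op_nth mazur_type_unit)
  then show ?thesis
    using strictly_singular_ell1_ell2 range not_compl null_dim codim not_inj
      T_inj T_not_ss T_closed T_dim T_range T_well closed_subspace_null_space
    by (simp add: hybrid_type_def ill_posed_type_I_def well_posed_def uncomplemented_def)
qed

end
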